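(* Let $\mathbf{t}$ be the Tribonacci sequence, fixed point of $0\mapsto01$, $1\mapsto02$, $2\mapsto0$. For each $k\ge1$, the smallest integer $C_k\ge1$ such that $\mathbf{t}$ is $(k,C_k)$-balanced is $C_k=2$.
   Context: For positive integers $k,C$, a sequence $\mathbf{x}$ over alphabet $A$ is $(k,C)$-balanced if for all factors $u,v$ of $\mathbf{x}$ with $|u|=|v|$ and every $w\in A^k$, $||u|_w-|v|_w|\le C$, where $|u|_w$ is the number of (possibly overlapping) occurrences of $w$ in $u$. *)

theory Defs
  imports Main
begin

fun trib_img :: "nat \<Rightarrow> nat list" where
  "trib_img a = (if a = 0 then [0,1] else if a = 1 then [0,2] else [0])"

definition trib_morph :: "nat list \<Rightarrow> nat list" where
  "trib_morph u = concat (map trib_img u)"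

(* The Tribonacci word: the fixed point starting with 0. sigma^m(0) is a prefix of
   sigma^(m+1)(0) and has length >= m+1, so the n-th letter is read off sigma^(n+1)(0). *)
definition trib :: "nat \<Rightarrow> nat" where
  "trib n = ((trib_morph ^^ (Suc n)) [0]) ! n"

definition factor :: "(nat \<Rightarrow> 'a) \<Rightarrow> nat \<Rightarrow> nat \<Rightarrow> 'a list" where
  "factor x i n = map x [i..<i+n]"

definition occ :: "'a list \<Rightarrow> 'a list \<Rightarrow> nat" where
  "occ u w = card {j. j + length w \<le> length u \<and> take (length w) (drop j u) = w}"

definition balanced :: "'a set \<Rightarrow> nat \<Rightarrow> nat \<Rightarrow> (nat \<Rightarrow> 'a) \<Rightarrow> bool" where
  "balanced A k C x \<longleftrightarrow>
     (\<forall>i j n w. set w \<subseteq> A \<and> length w = k \<longrightarrow>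
        \<bar>int (occ (factor x i n) w) - int (occ (factor x j n) w)\<bar> \<le> int C)"

end

theory Submission
  imports Defs
begin

text \<open>
  Let \<open>\<sigma>\<close> be the substitution. Desubstituting a nonempty factor \<open>w\<close> repeatedly shows that its
  occurrences are the positions \<open>|\<sigma>\<^sup>n(t\<^sub>0 \<dots> t\<^bsub>i-1\<^esub>)| + c\<close> for some fixed \<open>n \<ge> 1\<close> and \<open>c\<close>. Two windows of equal length
  whose numbers of occurrences differ by 3 would give factors \<open>u\<close>, \<open>v\<close> with \<open>|u| = |v| + 1\<close> and
  \<open>|\<sigma>\<^sup>n(u)| < |\<sigma>\<^sup>n(v)|\<close>. This is impossible: for \<open>|u| = |v| + 1\<close> every letter occurs at most twice
  more often in \<open>u\<close> than in \<open>v\<close>, and the letter counts of \<open>u\<close> and \<open>v\<close> do not differ by \<open>(-2, 1, 2)\<close>; the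
  inequality \<open>|\<sigma>\<^sup>n(u)| \<ge> |\<sigma>\<^sup>n(v)|\<close> then is arithmetic with Tribonacci numbers. The bounds on letter
  counts follow by induction on the length, since the letters 0, 1, 2 occur at the
  positions of the above form with \<open>n = 1, 2, 3\<close>. Conversely, if \<open>w\<close> starts with 1 then \<open>n \<ge> 2\<close>, so
  \<open>|\<sigma>\<^sup>n(0)| \<ge> |\<sigma>\<^sup>n(2)| + 2\<close> and two windows differ by 2.
\<close>

section \<open>Block decomposition of the Tribonacci word\<close>

lemma trib_morph_append: "trib_morph (u @ v) = trib_morph u @ trib_morph v"
  by (simp add: trib_morph_def)

lemma trib_morph_pow_append: 
  "(trib_morph ^^ n) (u @ v) = (trib_morph ^^ n) u @ (trib_morph ^^ n) v"
  by (induction n) (auto simp: trib_morph_append)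

lemma length_trib_morph_ge: "length u \<le> length (trib_morph u)"
  by (induction u) (auto simp: trib_morph_def)

lemma set_trib_morph: "set (trib_morph u) \<subseteq> {0,1,2}"
  by (auto simp: trib_morph_def split: if_splits)

lemma trib_morph_pow_Suc:
  "(trib_morph ^^ Suc n) [0] = (trib_morph ^^ n) [0] @ (trib_morph ^^ n) [1]"
proof -
  have "(trib_morph ^^ Suc n) [0] = (trib_morph ^^ n) ([0] @ [1])"
    by (simp add: funpow_swap1 trib_morph_def)
  then show ?thesis
    by (simp only: trib_morph_pow_append)
qed

lemma length_trib_morph_pow_pos: "0 < length ((trib_morph ^^ n) [a])"
proof (induction n)
  case (Suc n)
  then show ?case
    using length_trib_morph_ge[of "(trib_morph ^^ n) [a]"] by (simp only: funpow.simps comp_apply)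
qed simp

lemma length_trib_morph_pow: "n < length ((trib_morph ^^ n) [0])"
proof (induction n)
  case (Suc n)
  have "0 < length ((trib_morph ^^ n) [1])"
    by (rule length_trib_morph_pow_pos)
  with Suc show ?case unfolding trib_morph_pow_Suc length_append by linarith
qed simp

lemma trib_morph_pow_nth_mono:
  "m \<le> n \<Longrightarrow> i < length ((trib_morph ^^ m) [0]) \<Longrightarrow>
     i < length ((trib_morph ^^ n) [0]) \<and>
     (trib_morph ^^ n) [0] ! i = (trib_morph ^^ m) [0] ! i"
proof (induction n rule: dec_induct)
  case (step n)
  then show ?case
    unfolding trib_morph_pow_Suc length_append by (auto simp: nth_append)
qed simp

lemma trib_nth: 
  assumes "i < length ((trib_morph ^^ n) [0])"
  shows "(trib_morph ^^ n) [0] ! i = trib i"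
proof -
  have "i < length ((trib_morph ^^ Suc i) [0])"
    using length_trib_morph_pow[of "Suc i"] by linarith
  then show ?thesis
    unfolding trib_def using assms 
    by (metis nle_le trib_morph_pow_nth_mono)
qed

lemma trib_morph_pow_eq:
  "(trib_morph ^^ n) [0] = map trib [0..<length ((trib_morph ^^ n) [0])]"
  by (rule nth_equalityI) (auto simp: trib_nth)

text \<open>As the word is fixed by the substitution, \<open>cut i\<close> is where the image of the
  letter \<open>trib i\<close> begins, and \<open>(cut ^^ n) i\<close> is where its
  \<open>n\<close>-th iterated image begins.\<close>

definition cut :: "nat \<Rightarrow> nat" where
  "cut i = length (trib_morph (map trib [0..<i]))"

text \<open>The prefix of length \<open>i\<close> lies inside the \<open>i\<close>-th iterated image
  of 0, whose image is again a prefix of the word.\<close>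

lemma trib_morph_prefix: "trib_morph (map trib [0..<i]) = map trib [0..<cut i]"
proof -
  let ?l = "length ((trib_morph ^^ i) [0])" and ?l' = "length ((trib_morph ^^ Suc i) [0])"
  have "[0..<?l] = [0..<i] @ [i..<?l]"
    using length_trib_morph_pow[of i] by (metis less_imp_add_positive le0 upt_add_eq_append)
  then have "trib_morph (map trib [0..<i]) @ trib_morph (map trib [i..<?l])
      = trib_morph (map trib [0..<?l])"
    by (simp add: trib_morph_append)
  also have "\<dots> = (trib_morph ^^ Suc i) [0]"
    using trib_morph_pow_eq[of i] by simp
  also have "\<dots> = map trib [0..<?l']"
    by (rule trib_morph_pow_eq)
  finally have eq: "trib_morph (map trib [0..<i]) @ trib_morph (map trib [i..<?l])
      = map trib [0..<?l']" .
  then have "cut i \<le> ?l'"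
    unfolding cut_def by (metis length_append length_map length_upt diff_zero le_add1)
  from arg_cong[OF eq, of "take (cut i)"] this show ?thesis
    by (simp add: cut_def take_map)
qed

lemma cut_0 [simp]: "cut 0 = 0"
  by (simp add: cut_def trib_morph_def)

lemma trib_le: "trib i \<le> 2"
proof -
  have "trib i \<in> set (map trib [0..<cut (Suc i)])"
    using length_trib_morph_ge[of "map trib [0..<Suc i]"] by (auto simp: cut_def)
  then show ?thesis
    using set_trib_morph[of "map trib [0..<Suc i]"] unfolding trib_morph_prefix by force
qed

lemma trib_cases: "trib i = 0 \<or> trib i = 1 \<or> trib i = 2"
  using trib_le[of i] by linarith

lemma map_trib_cut_Suc: "map trib [cut i..<cut (Suc i)] = trib_img (trib i)"
proof -
  have le: "cut i \<le> cut (Suc i)"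
    by (simp add: cut_def trib_morph_append)
  have "map trib [0..<cut (Suc i)] = map trib [0..<cut i] @ trib_img (trib i)"
    unfolding trib_morph_prefix[symmetric] by (simp add: trib_morph_append trib_morph_def)
  moreover have "[0..<cut (Suc i)] = [0..<cut i] @ [cut i..<cut (Suc i)]"
    using le by (metis le_add_diff_inverse le0 upt_add_eq_append)
  ultimately show ?thesis by simp
qed

lemma cut_Suc: "cut (Suc i) = cut i + (if trib i = 2 then 1 else 2)"
  using arg_cong[OF map_trib_cut_Suc[of i], of length] trib_cases[of i]
  by (auto simp: cut_def trib_morph_append trib_morph_def)

lemma trib_cut [simp]: "trib (cut i) = 0"
  using map_trib_cut_Suc[of i] trib_cases[of i] 
  by (auto simp: cut_Suc upt_rec split: if_splits)

lemma trib_Suc_cut: "trib i \<noteq> 2 \<Longrightarrow> trib (Suc (cut i)) = Suc (trib i)"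
  using map_trib_cut_Suc[of i] trib_cases[of i] 
  by (auto simp: cut_Suc upt_rec split: if_splits)

lemma strict_mono_cut: "strict_mono cut"
  by (simp add: strict_mono_Suc_iff cut_Suc)

lemma cut_exhaust:
  obtains (zero) y where "x = cut y" | (nonzero) y where "x = Suc (cut y)" "trib y \<noteq> 2"
proof -
  have "\<exists>y. x = cut y \<or> (x = Suc (cut y) \<and> trib y \<noteq> 2)"
  proof (induction x)
    case 0
    show ?case by (metis cut_0)
  next
    case (Suc x)
    then obtain y where "x = cut y \<or> (x = Suc (cut y) \<and> trib y \<noteq> 2)" by blast
    then show ?case
      by (cases "trib y = 2") (auto simp: cut_Suc intro: exI[of _ y] exI[of _ "Suc y"])
  qed
  then show thesis using that by blast
qed

lemma trib_eq_0: "trib x = 0 \<Longrightarrow> \<exists>y. x = cut y"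
  by (cases x rule: cut_exhaust) (auto simp: trib_Suc_cut)

lemma trib_neq_0: 
  "trib x \<noteq> 0 \<Longrightarrow> \<exists>y. x = Suc (cut y) \<and> trib y \<noteq> 2 \<and> trib x = Suc (trib y) \<and> Suc x = cut (Suc y)"
  by (cases x rule: cut_exhaust) (auto simp: trib_Suc_cut cut_Suc)

lemma strict_mono_cut_pow: "strict_mono (cut ^^ n)"
proof (induction n)
  case (Suc n)
  then show ?case using strict_mono_cut by (auto simp: strict_mono_def)
qed (simp add: strict_mono_def)

lemma cut_pow_0 [simp]: "(cut ^^ n) 0 = 0"
  by (induction n) auto


section \<open>Letter counts\<close>

definition cnt :: "nat \<Rightarrow> nat \<Rightarrow> nat" where
  "cnt a x = (\<Sum>j<x. of_bool (trib j = a))"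

lemma cnt_0 [simp]: "cnt a 0 = 0"
  by (simp add: cnt_def)

lemma cnt_Suc: "cnt a (Suc x) = cnt a x + of_bool (trib x = a)"
  by (simp add: cnt_def)

lemma mono_cnt: "mono (cnt a)"
  by (simp add: mono_iff_le_Suc cnt_Suc)

lemma cnt_sum: "cnt 0 x + cnt 1 x + cnt 2 x = x"
proof (induction x)
  case (Suc x)
  then show ?case using trib_cases[of x] by (auto simp: cnt_Suc)
qed simp

text \<open>Every image contains exactly one 0; a 1 arises only from 0 and a 2 only from 1.\<close>

lemma cnt_cut: "cnt 0 (cut i) = i" "cnt 1 (cut i) = cnt 0 i" "cnt 2 (cut i) = cnt 1 i"
proof (induction i)
  case (Suc i)
  {
    case 1 then show ?case using Suc trib_cases[of i]
      by (auto simp: cut_Suc cnt_Suc trib_Suc_cut)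
  next
    case 2 then show ?case using Suc trib_cases[of i]
      by (auto simp: cut_Suc cnt_Suc trib_Suc_cut)
  next
    case 3 then show ?case using Suc trib_cases[of i]
      by (auto simp: cut_Suc cnt_Suc trib_Suc_cut)
  }
qed auto

text \<open>\<open>len n a\<close> is the length of the \<open>n\<close>-th iterated image of the letter \<open>a\<close>.\<close>

fun len :: "nat \<Rightarrow> nat \<Rightarrow> nat" where
  "len 0 a = 1"
| "len (Suc n) a = (if a = 2 then len n 0 else len n 0 + len n (Suc a))"

lemma cut_pow_eq_cnt:
  "(cut ^^ n) i = len n 0 * cnt 0 i + len n 1 * cnt 1 i + len n 2 * cnt 2 i"
proof (induction n arbitrary: i)
  case 0
  then show ?case using cnt_sum[of i] by simp
next
  case (Suc n)
  have "(cut ^^ Suc n) i = (cut ^^ n) (cut i)"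
    by (simp add: funpow_swap1)
  also have "\<dots> = len n 0 * i + len n 1 * cnt 0 i + len n 2 * cnt 1 i"
    by (simp only: Suc cnt_cut)
  also have "\<dots> = len n 0 * (cnt 0 i + cnt 1 i + cnt 2 i) + len n 1 * cnt 0 i + len n 2 * cnt 1 i"
    by (simp only: cnt_sum)
  finally show ?case
    by (simp add: algebra_simps numeral_2_eq_2)
qed

lemma cut_pow_Suc: "(cut ^^ n) (Suc i) = (cut ^^ n) i + len n (trib i)"
  using trib_cases[of i] by (auto simp: cut_pow_eq_cnt cnt_Suc)

lemma len_bounds:
  "len n 0 \<le> 2 * len n 2 \<and> 2 * len n 0 \<le> 2 * len n 1 + len n 2 \<and>
   len n 2 \<le> len n 1 \<and> len n 1 \<le> len n 0 \<and> 1 \<le> len n 2"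
proof -
  have rec: "len (Suc n) 0 = len n 0 + len n 1" "len (Suc n) 1 = len n 0 + len n 2"
    "len (Suc n) 2 = len n 0" for n
    by (auto simp: numeral_2_eq_2)
  \<comment> \<open>The second bound at \<open>Suc n\<close> reduces to
    \<open>2 * len n 1 \<le> len n 0 + 2 * len n 2\<close>, so the induction carries this
    along.\<close>
  have "?thesis \<and> 2 * len n 1 \<le> len n 0 + 2 * len n 2 \<and> len n 0 \<le> len n 1 + len n 2"
  proof (induction n)
    case (Suc n)
    then show ?case unfolding rec by auto
  qed auto
  then show ?thesis by blast
qed


section \<open>Factors and recurrence\<close>

lemma length_factor [simp]: "length (factor x i n) = n"
  by (simp add: factor_def)

lemma factor_eq_iff: "factor x p n = factor x q n \<longleftrightarrow> (\<forall>l<n. x (p + l) = x (q + l))"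
  by (auto simp: factor_def list_eq_iff_nth_eq)

lemma factor_Suc: "factor x p (Suc n) = factor x p n @ [x (p + n)]"
  by (simp add: factor_def)

lemma factor_eq_shorten:
  "factor x p n = factor x q n \<Longrightarrow> i + m \<le> n \<Longrightarrow> factor x (p + i) m = factor x (q + i) m"
  by (simp add: factor_eq_iff add.assoc)

lemma cut_add_ge: "cut p + l \<le> cut (p + l)"
  by (induction l) (auto simp: cut_Suc)

lemma trib_morph_factor: "trib_morph (factor trib p n) = factor trib (cut p) (cut (p + n) - cut p)"
proof -
  have "map trib [0..<cut p] @ trib_morph (factor trib p n) = trib_morph (map trib [0..<p + n])"
    unfolding trib_morph_prefix[symmetric] trib_morph_append[symmetric] factor_def
    by (metis map_append upt_add_eq_append le0)
  also have "\<dots> = map trib [0..<cut p + (cut (p + n) - cut p)]"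
    using cut_add_ge[of p n] by (simp add: trib_morph_prefix)
  also have "\<dots> = map trib [0..<cut p] @ factor trib (cut p) (cut (p + n) - cut p)"
    unfolding factor_def by (metis map_append upt_add_eq_append le0)
  finally show ?thesis by simp
qed

text \<open>Equal words have equal images; the extra letter is the 0 that begins the next
  image.\<close>

lemma factor_eq_cut:
  assumes "factor trib p n = factor trib q n"
  shows "cut (p + n) - cut p = cut (q + n) - cut q"
    and "factor trib (cut p) (Suc (cut (p + n) - cut p)) =
         factor trib (cut q) (Suc (cut (p + n) - cut p))"
proof -
  from assms have eq: "factor trib (cut p) (cut (p + n) - cut p) = factor trib (cut q) (cut (q + n) - cut q)"
    unfolding trib_morph_factor[symmetric] by simp
  then show len: "cut (p + n) - cut p = cut (q + n) - cut q"
    by (metis length_factor)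
  have "cut p + (cut (p + n) - cut p) = cut (p + n)" "cut q + (cut (p + n) - cut p) = cut (q + n)"
    unfolding len using cut_add_ge[of q n] cut_add_ge[of p n] len by auto
  with eq len show "factor trib (cut p) (Suc (cut (p + n) - cut p)) =
         factor trib (cut q) (Suc (cut (p + n) - cut p))"
    by (simp add: factor_Suc)
qed

lemma factor_eq_cut_0:
  assumes "factor trib x d = factor trib 0 d"
  shows "cut (x + d) = cut x + cut d" "factor trib (cut x) (Suc (cut d)) = factor trib 0 (Suc (cut d))"
  using factor_eq_cut[OF assms] cut_add_ge[of x d] by auto

text \<open>The letter at \<open>cut (Suc B)\<close> is 0, so iterated images of 0, which are
  prefixes of the word, recur beyond \<open>B\<close>; a long enough one contains the given
  factor.\<close>

lemma trib_recurrent: "\<exists>b'>B. factor trib b' n = factor trib b n"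
proof -
  let ?i = "cut (Suc B)"
  have eq: "factor trib ((cut ^^ m) ?i) ((cut ^^ m) 1) = factor trib 0 ((cut ^^ m) 1)" for m
  proof (induction m)
    case 0
    show ?case using trib_cut[of 0] by (simp add: factor_eq_iff)
  next
    case (Suc m)
    from factor_eq_cut_0(2)[OF Suc] show ?case by (simp add: factor_Suc)
  qed
  have large: "m < (cut ^^ m) 1" for m
  proof (induction m)
    case (Suc m)
    then obtain y where y: "(cut ^^ m) 1 = 1 + y" by (metis le_add_diff_inverse less_one not_less gr_implies_not0)
    have "cut 1 = 2" using cut_Suc[of 0] trib_cut[of 0] by simp
    with cut_add_ge[of 1 y] Suc y show ?case by simp
  qed simp
  have "factor trib ((cut ^^ (b + n)) ?i + b) n = factor trib (0 + b) n"
    by (rule factor_eq_shorten[OF eq]) (use large[of "b + n"] in simp)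
  moreover have "B < (cut ^^ (b + n)) ?i + b"
    using strict_mono_imp_increasing[OF strict_mono_cut_pow, of ?i "b + n"]
      strict_mono_imp_increasing[OF strict_mono_cut, of "Suc B"] by simp
  ultimately show ?thesis by auto
qed

lemma cnt_add: "cnt a (j + m) = cnt a j + count_list (factor trib j m) a"
  by (induction m) (auto simp: cnt_Suc factor_Suc factor_def)


section \<open>Lengths of consecutive blocks\<close>

text \<open>\<open>F x\<close> counts the points \<open>s l + off\<close> below \<open>x\<close>. If a window of length \<open>N + 1\<close> had three points
  more than one of length \<open>N\<close>, then \<open>m + 2\<close> consecutive gaps would be shorter than \<open>m + 1\<close>
  consecutive gaps elsewhere. The gap preceding the second window needs a point
  before \<open>b\<close>.\<close>

lemma window_count:
  fixes F s :: "nat \<Rightarrow> nat"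
  assumes F: "\<And>i x. i < F x \<longleftrightarrow> s i + off < x"
    and gaps: "\<And>i j. s (j + Suc m) + s i \<le> s (i + Suc (Suc m)) + s j"
    and b: "s 0 + off < b"
    and m: "F (b + N) = F b + m"
  shows "F (Suc (a + N)) \<le> F a + m + 2"
proof (rule ccontr)
  assume "\<not> ?thesis"
  then have "s (F a + m + 2) + off < Suc (a + N)"
    unfolding F[symmetric] by simp
  moreover have "a \<le> s (F a) + off"
    using F[of "F a" a] by simp
  moreover have pos: "0 < F b"
    using F b by blast
  then have "s (F b - 1) + off < b"
    unfolding F[symmetric] by simp
  moreover have "b + N \<le> s (F b + m) + off"
    using F[of "F b + m" "b + N"] m by simp
  moreover have "s (F b + m) + s (F a) \<le> s (F a + m + 2) + s (F b - 1)"
    using gaps[of "F b - 1" "F a"] pos by simp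
  ultimately show False by linarith
qed

definition blocks_le :: "nat \<Rightarrow> nat \<Rightarrow> bool" where
  "blocks_le n m \<longleftrightarrow>
     (\<forall>i j. (cut ^^ n) (j + m) + (cut ^^ n) i \<le> (cut ^^ n) (i + Suc m) + (cut ^^ n) j)"

text \<open>The excluded triple of count differences is the only one that is compatible with the
  other bounds and makes \<open>blocks_le\<close> fail.\<close>

definition cnt_balanced :: "nat \<Rightarrow> bool" where
  "cnt_balanced m \<longleftrightarrow> (\<forall>i j.
     (\<forall>a\<le>2. cnt a (i + Suc m) + cnt a j \<le> cnt a i + cnt a (j + m) + 2) \<and>
     \<not> (cnt 0 (i + Suc m) + cnt 0 j + 2 = cnt 0 i + cnt 0 (j + m) \<and>
        cnt 1 (i + Suc m) + cnt 1 j = cnt 1 i + cnt 1 (j + m) + 1 \<and>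
        cnt 2 (i + Suc m) + cnt 2 j = cnt 2 i + cnt 2 (j + m) + 2))"

text \<open>Each of the finitely many triples leaves a linear consequence of the length bounds. The
  excluded one gives -1 for 4, 3, 2, the lengths of the second iterated images.\<close>

lemma weighted_sum_nonneg:
  fixes l0 l1 l2 d0 d1 d2 :: int
  assumes l: "l0 \<le> 2 * l2" "2 * l0 \<le> 2 * l1 + l2" "l2 \<le> l1" "l1 \<le> l0" "1 \<le> l2"
    and d: "d0 + d1 + d2 = 1" "-2 \<le> d0" "-2 \<le> d1" "d0 \<le> 2" "d1 \<le> 2" "d2 \<le> 2"
    and ex: "\<not> (d0 = -2 \<and> d1 = 1)"
  shows "0 \<le> l0 * d0 + l1 * d1 + l2 * d2"
proof -
  have "d0 \<in> {-2, -1, 0, 1, 2}" "d1 \<in> {-2, -1, 0, 1, 2}" "d2 = 1 - d0 - d1"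
    using d by auto
  with d(6) ex l show ?thesis by auto
qed

lemma cnt_balanced_imp_blocks_le:
  assumes "cnt_balanced m"
  shows "blocks_le n m"
  unfolding blocks_le_def
proof (intro allI)
  fix i j
  define d where "d a = int (cnt a (i + Suc m)) + int (cnt a j) - int (cnt a i) - int (cnt a (j + m))" for a
  have upper: "d a \<le> 2" if "a \<le> 2" for a
  proof -
    have "cnt a (i + Suc m) + cnt a j \<le> cnt a i + cnt a (j + m) + 2"
      using assms that unfolding cnt_balanced_def by blast
    then show ?thesis unfolding d_def by linarith
  qed
  have lower: "-2 \<le> d a" if "a \<le> 2" for a
  proof -
    \<comment> \<open>The windows exchange roles: \<open>j\<close> gets the longer one. Restoring
      the original lengths can only increase \<open>d a\<close>.\<close>
    have "cnt a (j + Suc m) + cnt a i \<le> cnt a j + cnt a (i + m) + 2"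
      using assms that unfolding cnt_balanced_def by blast
    moreover have "cnt a (i + m) \<le> cnt a (i + Suc m)" "cnt a (j + m) \<le> cnt a (j + Suc m)"
      by (auto intro!: monoD[OF mono_cnt])
    ultimately show ?thesis unfolding d_def by linarith
  qed
  have "d 0 + d 1 + d 2 = 1"
    using cnt_sum[of "i + Suc m"] cnt_sum[of i] cnt_sum[of j] cnt_sum[of "j + m"]
    unfolding d_def by linarith
  moreover have "\<not> (d 0 = -2 \<and> d 1 = 1)"
  proof
    assume *: "d 0 = -2 \<and> d 1 = 1"
    with calculation have "d 2 = 2" by simp
    with * show False
      using assms unfolding cnt_balanced_def d_def by (elim allE[of _ i] allE[of _ j]) linarith
  qed
  ultimately have "0 \<le> int (len n 0) * d 0 + int (len n 1) * d 1 + int (len n 2) * d 2"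
    using len_bounds[of n] upper lower by (intro weighted_sum_nonneg) auto
  then have "int ((cut ^^ n) (j + m) + (cut ^^ n) i) \<le> int ((cut ^^ n) (i + Suc m) + (cut ^^ n) j)"
    unfolding cut_pow_eq_cnt d_def by (simp add: algebra_simps)
  then show "(cut ^^ n) (j + m) + (cut ^^ n) i \<le> (cut ^^ n) (i + Suc m) + (cut ^^ n) j"
    by linarith
qed

lemma less_cnt_iff:
  assumes "\<And>i. cnt a (p i) = i" "\<And>i. trib (p i) = a"
  shows "i < cnt a x \<longleftrightarrow> p i < x"
proof
  assume "i < cnt a x"
  then show "p i < x"
    using assms(1)[of i] monoD[OF mono_cnt, of x "p i" a] by (cases "x \<le> p i") auto
next
  assume "p i < x"
  then show "i < cnt a x"
    using assms[of i] monoD[OF mono_cnt, of "Suc (p i)" x a] by (simp add: cnt_Suc)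
qed

text \<open>The letters 1 and 2 occur only inside \<open>010\<close> and \<open>0102010\<close>. Every second, respectively third,
  iterated image of a letter, continued to the right, starts with this word.\<close>

lemma less_cnt_iff_cut_pow:
  assumes "a \<le> 2"
  shows "\<exists>n off. \<forall>i x. i < cnt a x \<longleftrightarrow> (cut ^^ n) i + off < x"
proof -
  have one: "cnt 1 (Suc (cut (cut i))) = i" "trib (Suc (cut (cut i))) = 1" for i
    by (simp_all add: cnt_Suc cnt_cut[simplified] trib_Suc_cut)
  have two: "cnt 2 (Suc (cut (Suc (cut (cut i))))) = i" "trib (Suc (cut (Suc (cut (cut i))))) = 2" for i
    using one[of i] by (simp_all add: cnt_Suc cnt_cut trib_Suc_cut)
  have "i < cnt 0 x \<longleftrightarrow> (cut ^^ 1) i + 0 < x" for i x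
    using less_cnt_iff[of 0 cut] by (simp add: cnt_cut)
  moreover have "i < cnt 1 x \<longleftrightarrow> (cut ^^ 2) i + 1 < x" for i x
    using less_cnt_iff[of 1 "\<lambda>i. Suc (cut (cut i))"] one by (simp add: numeral_2_eq_2)
  moreover have "i < cnt 2 x \<longleftrightarrow> (cut ^^ 3) i + 3 < x" for i x
    using less_cnt_iff[of 2 "\<lambda>i. Suc (cut (Suc (cut (cut i))))"] two
    by (simp add: numeral_3_eq_3 cut_Suc)
  ultimately show ?thesis
    using assms by (metis One_nat_def le_SucE le_zero_eq numeral_2_eq_2)
qed

text \<open>Positions of a letter are shifted block starts, so a difference of 3 would violate
  \<open>blocks_le\<close> for fewer than \<open>m\<close> blocks.\<close>

lemma cnt_upper:
  assumes IH: "\<And>m'. m' < m \<Longrightarrow> cnt_balanced m'" and a: "a \<le> 2"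
  shows "cnt a (i + Suc m) + cnt a j \<le> cnt a i + cnt a (j + m) + 2"
proof -
  obtain n off where F: "\<And>i x. i < cnt a x \<longleftrightarrow> (cut ^^ n) i + off < x"
    using less_cnt_iff_cut_pow[OF a] by blast
  \<comment> \<open>Moving the shorter window beyond \<open>off\<close>, the first position of
    \<open>a\<close>, provides the earlier point that \<open>window_count\<close> requires.\<close>
  obtain b where b: "off < b" "factor trib b m = factor trib j m"
    using trib_recurrent by blast
  define c where "c = count_list (factor trib j m) a"
  have c: "cnt a (b + m) = cnt a b + c" "cnt a (j + m) = cnt a j + c"
    by (simp_all add: cnt_add b c_def)
  have "cnt a (Suc (i + m)) \<le> cnt a i + c + 2"
  proof (rule ccontr)
    assume neg: "\<not> ?thesis"
    have "count_list (factor trib i (Suc m)) a \<le> Suc m"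
      by (metis count_le_length length_factor)
    \<comment> \<open>The longer window has at least \<open>c + 3\<close> occurrences among
      \<open>Suc m\<close> letters.\<close>
    with neg cnt_add[of a i "Suc m"] have "Suc c < m" by simp
    then have "blocks_le n (Suc c)"
      by (intro cnt_balanced_imp_blocks_le IH)
    with F c b neg show False
      using window_count[of "cnt a" "cut ^^ n" off c b m i] by (auto simp: blocks_le_def)
  qed
  with c show ?thesis by simp
qed

text \<open>In the excluded case both words can be completed to images under the substitution, and the
  preimages have a difference of 3 in their numbers of 2s.\<close>

lemma cnt_excluded:
  assumes IH: "\<And>m'. m' < m \<Longrightarrow> cnt_balanced m'"
    and d0: "cnt 0 (i + Suc m) + cnt 0 j + 2 = cnt 0 i + cnt 0 (j + m)"
    and d1: "cnt 1 (i + Suc m) + cnt 1 j = cnt 1 i + cnt 1 (j + m) + 1"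
    and d2: "cnt 2 (i + Suc m) + cnt 2 j = cnt 2 i + cnt 2 (j + m) + 2"
    and j: "0 < j"
  shows False
proof -
  have up: "cnt 0 (x + Suc m) + cnt 0 y \<le> cnt 0 x + cnt 0 (y + m) + 2" for x y
    by (rule cnt_upper) (use IH in auto)
  \<comment> \<open>The longer window has two 0s fewer than the shorter one. A 0 adjacent to the
    shorter window or at an end of the longer one could be added or removed, making the difference 3
    against \<open>up\<close>.\<close>
  have vr: "trib (j + m) \<noteq> 0"
  proof
    assume "trib (j + m) = 0"
    then show False
      using up[of j i] d0 monoD[OF mono_cnt, of "i + m" "i + Suc m" 0] by (simp add: cnt_Suc)
  qed
  have vl: "trib (j - 1) \<noteq> 0"
  proof
    assume "trib (j - 1) = 0"
    then show False
      using up[of "j - 1" i] d0 j monoD[OF mono_cnt, of "i + m" "i + Suc m" 0] cnt_Suc[of 0 "j - 1"]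
      by simp
  qed
  have ul: "trib i \<noteq> 0"
  proof
    assume "trib i = 0"
    then show False
      using up[of j "Suc i"] d0 monoD[OF mono_cnt, of "j + m" "j + Suc m" 0] by (simp add: cnt_Suc)
  qed
  have ur: "trib (i + m) \<noteq> 0"
  proof
    assume "trib (i + m) = 0"
    then show False
      using up[of j i] d0 monoD[OF mono_cnt, of "j + m" "j + Suc m" 0] by (simp add: cnt_Suc)
  qed
  \<comment> \<open>The longer window, with a 0 prepended, is the image of the letters from
    \<open>i1\<close> to before \<open>i2\<close>; the shorter one, with its next letter appended,
    is that of the letters from \<open>j1\<close> to before \<open>j2\<close>.\<close>
  obtain i1 where i1: "i = Suc (cut i1)"
    using trib_neq_0[OF ul] by blast
  obtain i2 where i2: "i + Suc m = cut i2"
    using trib_neq_0[OF ur] by auto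
  obtain j1 where j1: "j = cut j1"
    using trib_neq_0[OF vl] j by auto
  obtain j2 where j2: "j + Suc m = cut j2"
    using trib_neq_0[OF vr] by auto
  have j_end: "cnt a (j + Suc m) = cnt a (j + m) + of_bool (trib (j + m) = a)" for a
    by (simp add: cnt_Suc)
  have i_start: "cnt 0 i = Suc i1" "cnt 1 i = cnt 0 i1" "cnt 2 i = cnt 1 i1"
    by (simp_all add: i1 cnt_Suc cnt_cut[simplified])
  have j_start: "cnt 0 j = j1" "cnt 1 j = cnt 0 j1" "cnt 2 j = cnt 1 j1"
    unfolding j1 by (rule cnt_cut)+
  have i_stop: "cnt 0 (i + Suc m) = i2" "cnt 1 (i + Suc m) = cnt 0 i2" "cnt 2 (i + Suc m) = cnt 1 i2"
    unfolding i2 by (rule cnt_cut)+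
  have j_stop: "cnt 0 (j + m) = j2" 
    "cnt 0 j2 = cnt 1 (j + m) + of_bool (trib (j + m) = 1)"
    "cnt 1 j2 = cnt 2 (j + m) + of_bool (trib (j + m) = 2)"
    using j_end[of 0] j_end[of 1] j_end[of 2] cnt_cut[of j2] vr unfolding j2 by auto
  \<comment> \<open>Counting 0s measures the preimages: the shorter window has the preimage that is
    longer by one letter.\<close>
  have sum: "i2 + j1 + 1 = i1 + j2"
    using d0 unfolding i_start j_start i_stop j_stop(1) by simp
  have "i1 < i2"
    using i1 i2 strict_mono_less[OF strict_mono_cut, of i1 i2] by simp
  define M where "M = i2 - i1"
  have i2_eq: "i2 = i1 + M" and j2_eq: "j2 = j1 + Suc M"
    using sum \<open>i1 < i2\<close> by (auto simp: M_def)
  have "cnt 0 (j + m) \<le> cnt 0 j + m"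
    by (simp add: cnt_add) (metis count_le_length length_factor)
  with j_start(1) j_stop(1) j2_eq have "M < m" by simp
  from IH[OF this] have "cnt 2 j2 + cnt 2 i1 \<le> cnt 2 j1 + cnt 2 i2 + 2"
    unfolding cnt_balanced_def i2_eq j2_eq by blast
  moreover have "of_bool (trib (j + m) = 1) + of_bool (trib (j + m) = 2) = (1::nat)"
    using vr trib_cases[of "j + m"] by auto
  ultimately show False
    using d1 d2 cnt_sum[of i1] cnt_sum[of i2] cnt_sum[of j1] cnt_sum[of j2] sum
    unfolding i_start j_start i_stop j_stop(2,3) by linarith
qed

lemma cnt_balanced: "cnt_balanced m"
proof (induction m rule: less_induct)
  case (less m)
  show ?case unfolding cnt_balanced_def
  proof (intro allI conjI impI notI)
    fix i j a :: nat
    assume "a \<le> 2"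
    with less show "cnt a (i + Suc m) + cnt a j \<le> cnt a i + cnt a (j + m) + 2"
      by (rule cnt_upper)
  next
    fix i j
    \<comment> \<open>A later copy of the shorter window has a letter before it, which
      \<open>cnt_excluded\<close> inspects.\<close>
    obtain b where b: "0 < b" "factor trib b m = factor trib j m"
      using trib_recurrent by blast
    assume "cnt 0 (i + Suc m) + cnt 0 j + 2 = cnt 0 i + cnt 0 (j + m) \<and>
        cnt 1 (i + Suc m) + cnt 1 j = cnt 1 i + cnt 1 (j + m) + 1 \<and>
        cnt 2 (i + Suc m) + cnt 2 j = cnt 2 i + cnt 2 (j + m) + 2"
    with b show False
      by (intro cnt_excluded[OF less, of m i b]) (auto simp: cnt_add)
  qed
qed

lemma consecutive_blocks: 
  "(cut ^^ n) (j + m) + (cut ^^ n) i \<le> (cut ^^ n) (i + Suc m) + (cut ^^ n) j"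
  using cnt_balanced_imp_blocks_le[OF cnt_balanced] unfolding blocks_le_def by blast


section \<open>Occurrences of a factor\<close>

lemma trib_Suc_cut_inj: "trib (Suc (cut x)) = trib (Suc (cut y)) \<Longrightarrow> trib x = trib y"
proof -
  have "trib (Suc (cut z)) = (if trib z = 2 then 0 else Suc (trib z))" for z
    using trib_cut[of "Suc z"] by (cases "trib z = 2") (simp_all add: cut_Suc trib_Suc_cut)
  then show "trib (Suc (cut x)) = trib (Suc (cut y)) \<Longrightarrow> trib x = trib y"
    using trib_cases[of x] trib_cases[of y] by (auto split: if_splits)
qed

text \<open>The second letter of a block, or the first letter of the next one, determines the block.\<close>

lemma factor_eq_uncut:
  assumes eq: "factor trib (cut p) K = factor trib (cut q) K"
  shows "(0 < k \<Longrightarrow> cut (p + (k - 1)) + 2 \<le> cut p + K) \<Longrightarrow> factor trib p k = factor trib q k"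
proof (induction k)
  case (Suc k)
  have "cut (p + (k - 1)) \<le> cut (p + k)"
    using strict_mono_cut by (simp add: strict_mono_less_eq)
  with Suc(2) have "cut (p + (k - 1)) + 2 \<le> cut p + K" by simp
  then have IH: "factor trib p k = factor trib q k" by (rule Suc.IH)
  define D where "D = cut (p + k) - cut p"
  have D: "cut (p + k) = cut p + D" "cut (q + k) = cut q + D"
    using factor_eq_cut(1)[OF IH] cut_add_ge[of p k] cut_add_ge[of q k] by (auto simp: D_def)
  have "Suc D < K"
    using Suc(2) D by simp
  then have "trib (Suc (cut (p + k))) = trib (Suc (cut (q + k)))"
    using eq D by (auto simp: factor_eq_iff dest: spec[of _ "Suc D"])
  then have "trib (p + k) = trib (q + k)"
    by (rule trib_Suc_cut_inj)
  with IH show ?case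
    by (simp add: factor_Suc)
qed (simp add: factor_def)

lemma factor_desubstitute:
  assumes "2 \<le> K"
  obtains k where "1 \<le> k" "k < K"
    "\<And>q. factor trib q K = factor trib (cut p) K \<longleftrightarrow>
          (\<exists>q'. q = cut q' \<and> factor trib q' k = factor trib p k)"
proof -
  \<comment> \<open>The images of \<open>k\<close> letters and the 0 after them just cover the
    window. By minimality the window reaches the second position of the last block, which determines
    its letter.\<close>
  define k where "k = (LEAST k. cut p + K \<le> Suc (cut (p + k)))"
  have ub: "cut p + K \<le> Suc (cut (p + k))"
    unfolding k_def by (rule LeastI[of _ K]) (use cut_add_ge[of p K] in simp)
  with assms have k: "1 \<le> k" by (cases k) auto
  then have "\<not> cut p + K \<le> Suc (cut (p + (k - 1)))"
    unfolding k_def by (intro not_less_Least) simp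
  then have lb: "cut (p + (k - 1)) + 2 \<le> cut p + K" by simp
  with cut_add_ge[of p "k - 1"] k have "k < K" by simp
  moreover have "factor trib q K = factor trib (cut p) K \<longleftrightarrow>
          (\<exists>q'. q = cut q' \<and> factor trib q' k = factor trib p k)" for q
  proof
    assume eq: "factor trib q K = factor trib (cut p) K"
    then have "trib q = 0"
      using assms by (auto simp: factor_eq_iff dest: spec[of _ 0])
    then obtain q' where q': "q = cut q'"
      using trib_eq_0 by blast
    from eq lb have "factor trib p k = factor trib q' k"
      unfolding q' by (intro factor_eq_uncut[of p K]) auto
    with q' show "\<exists>q'. q = cut q' \<and> factor trib q' k = factor trib p k" by auto
  next
    assume "\<exists>q'. q = cut q' \<and> factor trib q' k = factor trib p k"
    then obtain q' where q': "q = cut q'" "factor trib p k = factor trib q' k" by auto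
    have "factor trib (cut p + 0) K = factor trib (cut q' + 0) K"
      by (rule factor_eq_shorten[OF factor_eq_cut(2)[OF q'(2)]]) (use ub in simp)
    with q' show "factor trib q K = factor trib (cut p) K" by simp
  qed
  ultimately show thesis using that k by blast
qed

text \<open>A factor starting with 1 or 2 is always preceded by 0 and is extended by it before
  desubstitution. The preimage may then be as long as the factor but starts earlier, hence the
  induction on \<open>p + k\<close>. The last conjunct makes \<open>cut\<close> additive on
  \<open>(cut ^^ n) i + off\<close>.\<close>

lemma factor_occurrences:
  assumes "1 \<le> k"
  shows "\<exists>n off. 1 \<le> n \<and> (trib p \<noteq> 0 \<longrightarrow> 2 \<le> n) \<and>
    (\<forall>q. factor trib q k = factor trib p k \<longleftrightarrow> (\<exists>i. q = (cut ^^ n) i + off)) \<and>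
    (\<forall>i. factor trib ((cut ^^ n) i) off = factor trib 0 off)"
  using assms
proof (induction "p + k" arbitrary: p k rule: less_induct)
  case less
  show ?case
  proof (cases "trib p = 0")
    case True
    then obtain p' where p: "p = cut p'"
      using trib_eq_0 by blast
    show ?thesis
    proof (cases "k = 1")
      case k: True
      have "factor trib q k = factor trib p k \<longleftrightarrow> (\<exists>i. q = (cut ^^ 1) i + 0)" for q
        using True trib_eq_0 by (auto simp: k factor_eq_iff)
      moreover have "factor trib ((cut ^^ 1) i) 0 = factor trib 0 0" for i
        by (simp add: factor_def)
      ultimately show ?thesis using True by blast
    next
      case False
      with less.prems have "2 \<le> k" by simp
      then obtain k' where k': "1 \<le> k'" "k' < k"
        and occ: "\<And>q. factor trib q k = factor trib p k \<longleftrightarrow>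
          (\<exists>q'. q = cut q' \<and> factor trib q' k' = factor trib p' k')"
        unfolding p by (rule factor_desubstitute[of k p']) blast
      have "p' \<le> p" using cut_add_ge[of 0 p'] p by simp
      with k' have "p' + k' < p + k" by simp
      from less.hyps[OF this k'(1)] obtain n off where n: "1 \<le> n"
        and occ': "\<And>q. factor trib q k' = factor trib p' k' \<longleftrightarrow> (\<exists>i. q = (cut ^^ n) i + off)"
        and pre: "\<And>i. factor trib ((cut ^^ n) i) off = factor trib 0 off" by blast
      have "factor trib q k = factor trib p k \<longleftrightarrow> (\<exists>i. q = (cut ^^ Suc n) i + cut off)" for q
        using factor_eq_cut_0(1)[OF pre] unfolding occ occ' by (metis comp_apply funpow.simps(2))
      moreover have "factor trib ((cut ^^ Suc n) i) (cut off) = factor trib 0 (cut off)" for i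
        using factor_eq_cut_0(2)[OF pre, of i] by (simp add: factor_Suc)
      ultimately show ?thesis using True by (intro exI[of _ "Suc n"] exI[of _ "cut off"]) auto
    qed
  next
    case False
    then obtain p' where p: "p = Suc (cut p')"
      using trib_neq_0 by blast
    have "2 \<le> Suc k" using less.prems by simp
    then obtain k' where k': "1 \<le> k'" "k' < Suc k"
      and occ: "\<And>q. factor trib q (Suc k) = factor trib (cut p') (Suc k) \<longleftrightarrow>
          (\<exists>q'. q = cut q' \<and> factor trib q' k' = factor trib p' k')"
      by (rule factor_desubstitute[of "Suc k" p']) blast
    have "p' < p" using cut_add_ge[of 0 p'] p by simp
    with k' have "p' + k' < p + k" by simp
    from less.hyps[OF this k'(1)] obtain n off where n: "1 \<le> n"
      and occ': "\<And>q. factor trib q k' = factor trib p' k' \<longleftrightarrow> (\<exists>i. q = (cut ^^ n) i + off)"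
      and pre: "\<And>i. factor trib ((cut ^^ n) i) off = factor trib 0 off" by blast
    have shift: "factor trib (Suc r) k = factor trib p k \<longleftrightarrow> 
        factor trib r (Suc k) = factor trib (cut p') (Suc k)" if "trib r = 0" for r
      using that by (auto simp: p factor_eq_iff less_Suc_eq_0_disj)
    have "factor trib q k = factor trib p k \<longleftrightarrow> (\<exists>i. q = (cut ^^ Suc n) i + Suc (cut off))" for q
    proof
      assume eq: "factor trib q k = factor trib p k"
      then have "trib q = trib p"
        using less.prems by (auto simp: factor_eq_iff dest: spec[of _ 0])
      then obtain r where r: "q = Suc r" "trib r = 0"
        using False trib_neq_0 by (metis trib_cut)
      with eq shift occ occ' obtain i where "r = cut ((cut ^^ n) i + off)" by auto
      with r show "\<exists>i. q = (cut ^^ Suc n) i + Suc (cut off)"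
        by (auto simp: factor_eq_cut_0(1)[OF pre])
    next
      assume "\<exists>i. q = (cut ^^ Suc n) i + Suc (cut off)"
      then obtain i where i: "q = Suc (cut ((cut ^^ n) i + off))"
        by (auto simp: factor_eq_cut_0(1)[OF pre])
      show "factor trib q k = factor trib p k"
        unfolding i by (subst shift) (auto simp: occ occ')
    qed
    moreover have "factor trib ((cut ^^ Suc n) i) (Suc (cut off)) = factor trib 0 (Suc (cut off))" for i
      using factor_eq_cut_0(2)[OF pre, of i] by simp
    ultimately show ?thesis using n
      by (intro exI[of _ "Suc n"] exI[of _ "Suc (cut off)"]) auto
  qed
qed

section \<open>Balance bound for the number of occurrences\<close>

lemma occ_factor:
  assumes "1 \<le> length w"
  shows "occ (factor x i n) w =
    card {q. i \<le> q \<and> q < i + (Suc n - length w) \<and> factor x q (length w) = w}"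
proof -
  have "take (length w) (drop j (factor x i n)) = factor x (i + j) (length w)"
    if "j + length w \<le> n" for j
    using that by (simp add: factor_def drop_map take_map)
  then have eq: "{j. j + length w \<le> length (factor x i n) \<and>
        take (length w) (drop j (factor x i n)) = w} =
      {j. j + length w \<le> n \<and> factor x (i + j) (length w) = w}"
    by auto
  have "bij_betw ((+) i) {j. j + length w \<le> n \<and> factor x (i + j) (length w) = w}
      {q. i \<le> q \<and> q < i + (Suc n - length w) \<and> factor x q (length w) = w}"
    by (rule bij_betw_byWitness[where f' = "\<lambda>q. q - i"]) (use assms in auto)
  then show ?thesis
    unfolding occ_def eq by (rule bij_betw_same_card)
qed

lemma occ_diff_le:
  assumes w: "1 \<le> length w"
  shows "occ (factor trib i n) w \<le> occ (factor trib j n) w + 2"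
proof (cases "\<exists>p. factor trib p (length w) = w")
  case False
  then show ?thesis using w by (simp add: occ_factor)
next
  case True
  then obtain p where p: "factor trib p (length w) = w" by blast
  from factor_occurrences[OF w, of p] obtain m off where
    occs: "\<And>q. factor trib q (length w) = w \<longleftrightarrow> (\<exists>l. q = (cut ^^ m) l + off)"
    unfolding p by blast
  define s where "s = cut ^^ m"
  have s: "strict_mono s" "s 0 = 0"
    by (simp_all add: s_def strict_mono_cut_pow)
  \<comment> \<open>\<open>F x\<close> is the number of occurrences of \<open>w\<close> that start
    before \<open>x\<close>, playing the role of \<open>cnt\<close> for letters.\<close>
  define F where "F x = (LEAST l. x \<le> s l + off)" for x
  have F: "l < F x \<longleftrightarrow> s l + off < x" for l x
  proof
    assume "l < F x"
    then show "s l + off < x"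
      unfolding F_def using not_less_Least not_le by blast
  next
    assume l: "s l + off < x"
    have "x \<le> s (F x) + off"
      unfolding F_def by (rule LeastI[of _ x]) (use strict_mono_imp_increasing[OF s(1), of x] in simp)
    with l have "s l < s (F x)" by simp
    then show "l < F x" using s(1) by (simp add: strict_mono_less)
  qed
  define N where "N = Suc n - length w"
  have count: "occ (factor trib a n) w = F (a + N) - F a" for a
  proof -
    have "{q. a \<le> q \<and> q < a + N \<and> factor trib q (length w) = w} = (\<lambda>l. s l + off) ` {F a..<F (a + N)}"
      unfolding occs s_def[symmetric] using F[of _ a] F[of _ "a + N"]
      by (auto simp: image_def Bex_def not_less[symmetric])
    moreover have "inj_on (\<lambda>l. s l + off) {F a..<F (a + N)}"
      using s(1) by (auto simp: inj_on_def strict_mono_eq)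
    ultimately show ?thesis
      using w by (simp add: occ_factor N_def card_image)
  qed
  have F_mono: "F x \<le> F y" if "x \<le> y" for x y
    using F[of "F y" x] F[of "F y" y] that by linarith
  obtain b where b: "off < b" "factor trib b n = factor trib j n"
    using trib_recurrent by blast
  have "F (b + N) = F b + occ (factor trib j n) w"
    using count[of b] b F_mono[of b "b + N"] by simp
  then have "F (Suc (i + N)) \<le> F i + occ (factor trib j n) w + 2"
    using F b s(2) consecutive_blocks[of m _ "Suc _"] unfolding s_def[symmetric]
    by (intro window_count[where F = F and s = s and off = off and b = b]) auto
  with count[of i] F_mono[of "i + N" "Suc (i + N)"] show ?thesis by simp
qed

section \<open>Sharpness of the bound 2\<close>

lemma trib_values: "trib 0 = 0" "trib 1 = 1" "trib 3 = 2"
proof -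
  have 0: "trib 0 = 0" using trib_cut[of 0] by simp
  then show 1: "trib 1 = 1" using trib_Suc_cut[of 0] by simp
  show "trib 0 = 0" by fact
  show "trib 3 = 2" using trib_Suc_cut[of 1] cut_Suc[of 0] 0 1 by (simp add: numeral_3_eq_3)
qed

lemma len_0_ge_len_2: "2 \<le> n \<Longrightarrow> len n 2 + 2 \<le> len n 0"
proof -
  assume "2 \<le> n"
  then obtain m where "n = Suc (Suc m)" by (metis Suc_diff_Suc Suc_le_lessD less_iff_Suc_add numeral_2_eq_2 add_Suc)
  then show ?thesis
    using len_bounds[of m] by (simp add: numeral_2_eq_2)
qed

text \<open>The word starts with a 1, so its occurrences are the starts of the iterated images of order
  \<open>n \<ge> 2\<close>, shifted by a constant. For \<open>n = 1\<close> the image of 0 is only one letter longer than that of 2.\<close>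

lemma occ_diff_witness:
  assumes k: "1 \<le> k"
  shows "\<exists>i j n. occ (factor trib j n) (factor trib 1 k) + 2 \<le> occ (factor trib i n) (factor trib 1 k)"
proof -
  let ?w = "factor trib 1 k"
  from factor_occurrences[OF k, of 1] obtain m off where m: "2 \<le> m"
    and occs: "\<And>q. factor trib q k = ?w \<longleftrightarrow> (\<exists>l. q = (cut ^^ m) l + off)"
    using trib_values by auto
  define s where "s = cut ^^ m"
  have s: "strict_mono s" "s 0 = 0" "s 1 = len m 0" "s 4 = s 3 + len m 2"
    using strict_mono_cut_pow cut_pow_Suc[of m 0] cut_pow_Suc[of m 3] trib_values
    by (simp_all add: s_def)
  \<comment> \<open>There are \<open>len m 2 + 1\<close> start positions: enough to include both
    ends of the gap for \<open>trib 3 = 2\<close>, yet all fit strictly inside the first gap, of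
    length \<open>len m 0\<close>.\<close>
  define n where "n = len m 2 + k"
  have n: "Suc n - k = Suc (len m 2)" by (simp add: n_def)
  have "occ (factor trib (Suc off) n) ?w = 0"
  proof -
    have False if "Suc off \<le> s l + off" "s l + off < Suc off + Suc (len m 2)" for l
    proof -
      have "s 0 < s l" using that s(2) by simp
      then have "1 \<le> l" using s(1) by (simp add: strict_mono_less)
      then have "s 1 \<le> s l" using s(1) by (simp add: strict_mono_less_eq)
      with s(3) that len_0_ge_len_2[OF m] show False by simp
    qed
    then have "{q. Suc off \<le> q \<and> q < Suc off + Suc (len m 2) \<and> factor trib q k = ?w} = {}"
      unfolding occs s_def[symmetric] by blast
    then show ?thesis using k n by (simp add: occ_factor)
  qed
  moreover have "2 \<le> occ (factor trib (s 3 + off) n) ?w"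
  proof -
    let ?A = "{q. s 3 + off \<le> q \<and> q < s 3 + off + Suc (len m 2) \<and> factor trib q k = ?w}"
    have "finite ?A" by (rule finite_subset[of _ "{..<s 3 + off + Suc (len m 2)}"]) auto
    moreover have "{s 3 + off, s 4 + off} \<subseteq> ?A"
      unfolding occs s_def[symmetric] using s(4) by (auto intro: exI[of _ 3] exI[of _ 4])
    ultimately have "card {s 3 + off, s 4 + off} \<le> card ?A" by (rule card_mono)
    moreover have "s 3 \<noteq> s 4" using s(1) by (simp add: strict_mono_eq)
    ultimately show ?thesis using k n by (simp add: occ_factor)
  qed
  ultimately show ?thesis by (intro exI[of _ "s 3 + off"] exI[of _ "Suc off"] exI[of _ n]) simp
qed

theorem theorem22:
  fixes k :: nat
  assumes "k \<ge> 1"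
  shows "balanced {0,1,2} k 2 trib \<and> (\<forall>C::nat. C \<ge> 1 \<and> balanced {0,1,2} k C trib \<longrightarrow> 2 \<le> C)"
proof (intro conjI allI impI)
  have "\<bar>int (occ (factor trib i n) w) - int (occ (factor trib j n) w)\<bar> \<le> int 2"
    if "length w = k" for i j n w
    using occ_diff_le[of w i n j] occ_diff_le[of w j n i] that assms by linarith
  then show "balanced {0,1,2} k 2 trib"
    unfolding balanced_def by blast
next
  fix C :: nat
  assume C: "C \<ge> 1 \<and> balanced {0,1,2} k C trib"
  obtain i j n where
    ijn: "occ (factor trib j n) (factor trib 1 k) + 2 \<le> occ (factor trib i n) (factor trib 1 k)"
    using occ_diff_witness[OF assms] by blast
  have "trib x \<in> {0,1,2}" for x
    using trib_cases[of x] by simp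
  then have "set (factor trib 1 k) \<subseteq> {0,1,2}"
    unfolding factor_def set_map by (rule image_subsetI)
  with C have "\<bar>int (occ (factor trib i n) (factor trib 1 k)) -
      int (occ (factor trib j n) (factor trib 1 k))\<bar> \<le> int C"
    unfolding balanced_def by simp
  with ijn show "2 \<le> C" by linarith
qed

end
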